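(* Let $(\mathcal X,f:\mathcal X\times\mathcal A\to\mathcal B)$ and $(\mathcal Y,g:\mathcal Y\times\mathcal B\to\mathcal A)$ be two adjoint 1-cells (the first from $\mathcal A$ to $\mathcal B$, left adjoint to the second from $\mathcal B$ to $\mathcal A$) in the graded coKleisli 2-category $\mathrm{coKl}^{\mathbf{Cat}}(W)$. Then $\mathcal X$ and $\mathcal Y$ are necessarily the terminal category $\mathcal I=\{\bullet\}$, and the adjunction amounts to a single ordinary adjunction $f_\bullet\dashv g_\bullet$, $f_\bullet:\mathcal A\rightleftarrows\mathcal B:g_\bullet$, in $\mathbf{Cat}$, associated to the only object of $\mathcal I$.
   Context: $W(\mathcal X,\mathcal A):=\mathcal X\times\mathcal A$ is the $(\mathbf{Cat},\times)$-graded comonad on $\mathbf{Cat}$. Its graded coKleisli 2-category $\mathrm{coKl}^{\mathbf{Cat}}(W)$ has: objects the categories; 1-cells $\mathcal A\to\mathcal B$ the pairs $(\mathcal X,f)$ with $\mathcal X$ a category and $f:\mathcal X\times\mathcal A\to\mathcal B$ a functor (write $f_x=f(x,-)$); 2-cells $(\mathcal X,f)\Rightarrow(\mathcal X',f')$ the pairs $(H,\theta)$ with $H:\mathcal X\to\mathcal X'$ a functor and $\theta:f\Rightarrow f'\circ(H\times\mathcal A)$ a natural transformation; the composite of $(\mathcal X,f):\mathcal A\to\mathcal B$ with $(\mathcal Y,g):\mathcal B\to\mathcal C$ is $(\mathcal Y\times\mathcal X,\ (y,x,a)\mapsto g(y,f(x,a)))$; the identity of $\mathcal A$ is $(\mathcal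 I,\ \mathcal I\times\mathcal A\cong\mathcal A)$ with $\mathcal I$ terminal. Horizontal composition of 2-cells uses the product of the grading functors, and equality of 2-cells means equality of both components (up to the canonical associativity and unit isomorphisms for products of categories). Thus the unit of an adjunction has a functor component $\mathcal I\to\mathcal Y\times\mathcal X$ and the counit has functor component $\mathcal X\times\mathcal Y\to\mathcal I$. *)

theory Defs
  imports "HOL-Library.FuncSet"
begin

section \<open>Categories, functors, natural transformations\<close>

text \<open>
  Objects and arrows are carrier sets inside types, so the empty category is allowed.
  \<open>Comp C n m\<close> is ``\<open>n\<close> after \<open>m\<close>''; its value is irrelevant unless \<open>Dom C n = Cod C m\<close>.
\<close>

record ('o, 'm) cat =
  Obj :: "'o set"
  Arr :: "'m set"
  Dom :: "'m \<Rightarrow> 'o"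
  Cod :: "'m \<Rightarrow> 'o"
  Idn :: "'o \<Rightarrow> 'm"
  Comp :: "'m \<Rightarrow> 'm \<Rightarrow> 'm"

locale category =
  fixes C :: "('o, 'm) cat"
  assumes Dom_in: "m \<in> Arr C \<Longrightarrow> Dom C m \<in> Obj C"
    and Cod_in: "m \<in> Arr C \<Longrightarrow> Cod C m \<in> Obj C"
    and Idn_in: "x \<in> Obj C \<Longrightarrow> Idn C x \<in> Arr C"
    and Dom_Idn: "x \<in> Obj C \<Longrightarrow> Dom C (Idn C x) = x"
    and Cod_Idn: "x \<in> Obj C \<Longrightarrow> Cod C (Idn C x) = x"
    and Comp_in: "\<lbrakk>m \<in> Arr C; n \<in> Arr C; Dom C n = Cod C m\<rbrakk> \<Longrightarrow> Comp C n m \<in> Arr C"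
    and Dom_Comp: "\<lbrakk>m \<in> Arr C; n \<in> Arr C; Dom C n = Cod C m\<rbrakk> \<Longrightarrow> Dom C (Comp C n m) = Dom C m"
    and Cod_Comp: "\<lbrakk>m \<in> Arr C; n \<in> Arr C; Dom C n = Cod C m\<rbrakk> \<Longrightarrow> Cod C (Comp C n m) = Cod C n"
    and Comp_Idn_right: "m \<in> Arr C \<Longrightarrow> Comp C m (Idn C (Dom C m)) = m"
    and Comp_Idn_left: "m \<in> Arr C \<Longrightarrow> Comp C (Idn C (Cod C m)) m = m"
    and Comp_assoc: "\<lbrakk>m \<in> Arr C; n \<in> Arr C; p \<in> Arr C; Dom C n = Cod C m; Dom C p = Cod C n\<rbrakk>
      \<Longrightarrow> Comp C p (Comp C n m) = Comp C (Comp C p n) m"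

definition prod_cat :: "('o, 'm) cat \<Rightarrow> ('p, 'n) cat \<Rightarrow> ('o \<times> 'p, 'm \<times> 'n) cat"
  (infixr \<open>\<times>\<^sub>C\<close> 75) where
  "C \<times>\<^sub>C D = \<lparr>Obj = Obj C \<times> Obj D, Arr = Arr C \<times> Arr D,
     Dom = (\<lambda>(m, n). (Dom C m, Dom D n)), Cod = (\<lambda>(m, n). (Cod C m, Cod D n)),
     Idn = (\<lambda>(x, y). (Idn C x, Idn D y)),
     Comp = (\<lambda>(m', n') (m, n). (Comp C m' m, Comp D n' n))\<rparr>"

definition one_cat :: "(unit, unit) cat" where
  "one_cat = \<lparr>Obj = {()}, Arr = {()}, Dom = (\<lambda>_. ()), Cod = (\<lambda>_. ()),
     Idn = (\<lambda>_. ()), Comp = (\<lambda>_ _. ())\<rparr>"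

text \<open>
  Functors and natural transformations are required to be extensional (\<open>undefined\<close> off the
  carriers), so that equality of functors and of transformations is equality in HOL.
\<close>

record ('o, 'm, 'p, 'n) functr =
  fobj :: "'o \<Rightarrow> 'p"
  farr :: "'m \<Rightarrow> 'n"

definition is_functor :: "('o, 'm) cat \<Rightarrow> ('p, 'n) cat \<Rightarrow> ('o, 'm, 'p, 'n) functr \<Rightarrow> bool" where
  "is_functor C D F \<longleftrightarrow>
     fobj F \<in> Obj C \<rightarrow>\<^sub>E Obj D \<and> farr F \<in> Arr C \<rightarrow>\<^sub>E Arr D \<and>
     (\<forall>m\<in>Arr C. Dom D (farr F m) = fobj F (Dom C m) \<and> Cod D (farr F m) = fobj F (Cod C m)) \<and>
     (\<forall>x\<in>Obj C. farr F (Idn C x) = Idn D (fobj F x)) \<and>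
     (\<forall>m\<in>Arr C. \<forall>n\<in>Arr C. Dom C n = Cod C m \<longrightarrow>
        farr F (Comp C n m) = Comp D (farr F n) (farr F m))"

definition mk_functor :: "('o, 'm) cat \<Rightarrow> ('o \<Rightarrow> 'p) \<Rightarrow> ('m \<Rightarrow> 'n) \<Rightarrow> ('o, 'm, 'p, 'n) functr" where
  "mk_functor C u v = \<lparr>fobj = restrict u (Obj C), farr = restrict v (Arr C)\<rparr>"

definition id_functor :: "('o, 'm) cat \<Rightarrow> ('o, 'm, 'o, 'm) functr" where
  "id_functor C = mk_functor C (\<lambda>x. x) (\<lambda>m. m)"

text \<open>In \<open>comp_functor C G F\<close>, \<open>C\<close> is the source of \<open>F\<close>.\<close>

definition comp_functor :: "('o, 'm) cat \<Rightarrow> ('p, 'n, 'q, 'k) functr \<Rightarrow> ('o, 'm, 'p, 'n) functr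
    \<Rightarrow> ('o, 'm, 'q, 'k) functr" where
  "comp_functor C G F = mk_functor C (\<lambda>x. fobj G (fobj F x)) (\<lambda>m. farr G (farr F m))"

text \<open>In \<open>prod_functor C D F G\<close>, \<open>C\<close> and \<open>D\<close> are the sources of \<open>F\<close> and \<open>G\<close>.\<close>

definition prod_functor :: "('o, 'm) cat \<Rightarrow> ('p, 'n) cat \<Rightarrow> ('o, 'm, 'q, 'k) functr
    \<Rightarrow> ('p, 'n, 'r, 'l) functr \<Rightarrow> ('o \<times> 'p, 'm \<times> 'n, 'q \<times> 'r, 'k \<times> 'l) functr" where
  "prod_functor C D F G = mk_functor (C \<times>\<^sub>C D)
     (\<lambda>(x, y). (fobj F x, fobj G y)) (\<lambda>(m, n). (farr F m, farr G n))"

definition is_nat_trans :: "('o, 'm) cat \<Rightarrow> ('p, 'n) cat \<Rightarrow> ('o, 'm, 'p, 'n) functr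
    \<Rightarrow> ('o, 'm, 'p, 'n) functr \<Rightarrow> ('o \<Rightarrow> 'n) \<Rightarrow> bool" where
  "is_nat_trans C D F G \<theta> \<longleftrightarrow>
     \<theta> \<in> Obj C \<rightarrow>\<^sub>E Arr D \<and>
     (\<forall>x\<in>Obj C. Dom D (\<theta> x) = fobj F x \<and> Cod D (\<theta> x) = fobj G x) \<and>
     (\<forall>m\<in>Arr C. Comp D (\<theta> (Cod C m)) (farr F m) = Comp D (farr G m) (\<theta> (Dom C m)))"

definition iso_cat :: "('o, 'm) cat \<Rightarrow> ('p, 'n) cat \<Rightarrow> bool" (infix \<open>\<cong>\<^sub>C\<close> 50) where
  "C \<cong>\<^sub>C D \<longleftrightarrow> (\<exists>F G. is_functor C D F \<and> is_functor D C G \<and>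
     comp_functor C G F = id_functor C \<and> comp_functor D F G = id_functor D)"

definition cat_adjunction :: "('ao, 'am) cat \<Rightarrow> ('bo, 'bm) cat \<Rightarrow> ('ao, 'am, 'bo, 'bm) functr
    \<Rightarrow> ('bo, 'bm, 'ao, 'am) functr \<Rightarrow> ('ao \<Rightarrow> 'am) \<Rightarrow> ('bo \<Rightarrow> 'bm) \<Rightarrow> bool" where
  "cat_adjunction A B F G \<eta> \<epsilon> \<longleftrightarrow>
     is_functor A B F \<and> is_functor B A G \<and>
     is_nat_trans A A (id_functor A) (comp_functor A G F) \<eta> \<and>
     is_nat_trans B B (comp_functor B F G) (id_functor B) \<epsilon> \<and>
     (\<forall>a\<in>Obj A. Comp B (\<epsilon> (fobj F a)) (farr F (\<eta> a)) = Idn B (fobj F a)) \<and>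
     (\<forall>b\<in>Obj B. Comp A (farr G (\<epsilon> b)) (\<eta> (fobj G b)) = Idn A (fobj G b))"


section \<open>The graded coKleisli 2-category of \<open>W(\<X>, \<A>) = \<X> \<times> \<A>\<close>\<close>

type_synonym ('xo, 'xm, 'ao, 'am, 'bo, 'bm) one_cell =
  "('xo, 'xm) cat \<times> ('xo \<times> 'ao, 'xm \<times> 'am, 'bo, 'bm) functr"

type_synonym ('xo, 'xm, 'yo, 'ym, 'ao, 'bm) two_cell =
  "('xo, 'xm, 'yo, 'ym) functr \<times> ('xo \<times> 'ao \<Rightarrow> 'bm)"

fun is_one_cell :: "('ao, 'am) cat \<Rightarrow> ('bo, 'bm) cat
    \<Rightarrow> ('xo, 'xm, 'ao, 'am, 'bo, 'bm) one_cell \<Rightarrow> bool" where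
  "is_one_cell A B (X, f) \<longleftrightarrow> category X \<and> is_functor (X \<times>\<^sub>C A) B f"

fun is_two_cell :: "('ao, 'am) cat \<Rightarrow> ('bo, 'bm) cat
    \<Rightarrow> ('xo, 'xm, 'ao, 'am, 'bo, 'bm) one_cell \<Rightarrow> ('yo, 'ym, 'ao, 'am, 'bo, 'bm) one_cell
    \<Rightarrow> ('xo, 'xm, 'yo, 'ym, 'ao, 'bm) two_cell \<Rightarrow> bool" where
  "is_two_cell A B (X, f) (X', f') (H, \<theta>) \<longleftrightarrow>
     is_functor X X' H \<and>
     is_nat_trans (X \<times>\<^sub>C A) B f
       (comp_functor (X \<times>\<^sub>C A) f' (prod_functor X A H (id_functor A))) \<theta>"

definition id1 :: "('ao, 'am) cat \<Rightarrow> (unit, unit, 'ao, 'am, 'ao, 'am) one_cell" where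
  "id1 A = (one_cat, mk_functor (one_cat \<times>\<^sub>C A) snd snd)"

text \<open>\<open>comp1 A G F\<close> is the composite ``\<open>G\<close> after \<open>F\<close>'', where \<open>A\<close> is the source of \<open>F\<close>.\<close>

fun comp1 :: "('ao, 'am) cat \<Rightarrow> ('yo, 'ym, 'bo, 'bm, 'co, 'cm) one_cell
    \<Rightarrow> ('xo, 'xm, 'ao, 'am, 'bo, 'bm) one_cell
    \<Rightarrow> ('yo \<times> 'xo, 'ym \<times> 'xm, 'ao, 'am, 'co, 'cm) one_cell" where
  "comp1 A (Y, g) (X, f) = (Y \<times>\<^sub>C X, mk_functor ((Y \<times>\<^sub>C X) \<times>\<^sub>C A)
     (\<lambda>((y, x), a). fobj g (y, fobj f (x, a)))
     (\<lambda>((n, m), k). farr g (n, farr f (m, k))))"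

text \<open>
  \<open>vcomp A B F \<beta> \<alpha>\<close> is the vertical composite ``\<open>\<beta>\<close> after \<open>\<alpha>\<close>'' of 2-cells between 1-cells
  \<open>A \<rightarrow> B\<close>, where \<open>F\<close> is the source of \<open>\<alpha>\<close>.
\<close>

fun vcomp :: "('ao, 'am) cat \<Rightarrow> ('bo, 'bm) cat \<Rightarrow> ('xo, 'xm, 'ao, 'am, 'bo, 'bm) one_cell
    \<Rightarrow> ('yo, 'ym, 'zo, 'zm, 'ao, 'bm) two_cell \<Rightarrow> ('xo, 'xm, 'yo, 'ym, 'ao, 'bm) two_cell
    \<Rightarrow> ('xo, 'xm, 'zo, 'zm, 'ao, 'bm) two_cell" where
  "vcomp A B (X, f) (H', \<theta>') (H, \<theta>) = (comp_functor X H' H,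
     restrict (\<lambda>(x, a). Comp B (\<theta>' (fobj H x, a)) (\<theta> (x, a))) (Obj (X \<times>\<^sub>C A)))"

text \<open>
  \<open>hcomp A C G G' F \<beta> \<alpha>\<close> is the horizontal composite \<open>G \<circ> F \<Rightarrow> G' \<circ> F'\<close> of \<open>\<alpha> : F \<Rightarrow> F' : A \<rightarrow> B\<close>
  and \<open>\<beta> : G \<Rightarrow> G' : B \<rightarrow> C\<close>; its component at \<open>((y, x), a)\<close> is
  \<open>g(y, f(x,a)) \<rightarrow> g'(K y, f(x,a)) \<rightarrow> g'(K y, f'(H x, a))\<close>.
\<close>

fun hcomp :: "('ao, 'am) cat \<Rightarrow> ('co, 'cm) cat
    \<Rightarrow> ('yo, 'ym, 'bo, 'bm, 'co, 'cm) one_cell \<Rightarrow> ('vo, 'vm, 'bo, 'bm, 'co, 'cm) one_cell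
    \<Rightarrow> ('xo, 'xm, 'ao, 'am, 'bo, 'bm) one_cell
    \<Rightarrow> ('yo, 'ym, 'vo, 'vm, 'bo, 'cm) two_cell \<Rightarrow> ('xo, 'xm, 'uo, 'um, 'ao, 'bm) two_cell
    \<Rightarrow> ('yo \<times> 'xo, 'ym \<times> 'xm, 'vo \<times> 'uo, 'vm \<times> 'um, 'ao, 'cm) two_cell" where
  "hcomp A C (Y, g) (Y', g') (X, f) (K, \<phi>) (H, \<theta>) = (prod_functor Y X K H,
     restrict (\<lambda>((y, x), a).
         Comp C (farr g' (Idn Y' (fobj K y), \<theta> (x, a))) (\<phi> (y, fobj f (x, a))))
       (Obj ((Y \<times>\<^sub>C X) \<times>\<^sub>C A)))"

text \<open>
  The 2-cell \<open>(H, id) : F \<Rightarrow> F'\<close>, available whenever \<open>f = f' \<circ> (H \<times> A)\<close>. With \<open>H\<close> a canonical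
  isomorphism of products these are the identity, associativity and unit 2-cells.
\<close>

fun canon :: "('ao, 'am) cat \<Rightarrow> ('bo, 'bm) cat \<Rightarrow> ('xo, 'xm, 'ao, 'am, 'bo, 'bm) one_cell
    \<Rightarrow> ('xo, 'xm, 'yo, 'ym) functr \<Rightarrow> ('xo, 'xm, 'yo, 'ym, 'ao, 'bm) two_cell" where
  "canon A B (X, f) H = (H, restrict (\<lambda>p. Idn B (fobj f p)) (Obj (X \<times>\<^sub>C A)))"

definition id2 :: "('ao, 'am) cat \<Rightarrow> ('bo, 'bm) cat \<Rightarrow> ('xo, 'xm, 'ao, 'am, 'bo, 'bm) one_cell
    \<Rightarrow> ('xo, 'xm, 'xo, 'xm, 'ao, 'bm) two_cell" where
  "id2 A B F = canon A B F (id_functor (fst F))"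

text \<open>\<open>F \<Rightarrow> F \<circ> 1\<close>, \<open>F \<circ> 1 \<Rightarrow> F\<close>, \<open>F \<Rightarrow> 1 \<circ> F\<close>, \<open>1 \<circ> F \<Rightarrow> F\<close>, for \<open>F : A \<rightarrow> B\<close>.\<close>

definition runit_inv where
  "runit_inv A B F = canon A B F (mk_functor (fst F) (\<lambda>x. (x, ())) (\<lambda>m. (m, ())))"

definition runit where
  "runit A B F = canon A B (comp1 A F (id1 A)) (mk_functor (fst F \<times>\<^sub>C one_cat) fst fst)"

definition lunit_inv where
  "lunit_inv A B F = canon A B F (mk_functor (fst F) (\<lambda>x. ((), x)) (\<lambda>m. ((), m)))"

definition lunit where
  "lunit A B F = canon A B (comp1 A (id1 B) F) (mk_functor (one_cat \<times>\<^sub>C fst F) snd snd)"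

text \<open>
  \<open>(H \<circ> G) \<circ> F \<Rightarrow> H \<circ> (G \<circ> F)\<close> and its inverse, for \<open>F : A \<rightarrow> B\<close>, \<open>G : B \<rightarrow> C\<close>, \<open>H : C \<rightarrow> D\<close>.
\<close>

definition assoc where
  "assoc A B D H G F = canon A D (comp1 A (comp1 B H G) F)
     (mk_functor ((fst H \<times>\<^sub>C fst G) \<times>\<^sub>C fst F)
        (\<lambda>((z, y), x). (z, (y, x))) (\<lambda>((z, y), x). (z, (y, x))))"

definition assoc_inv where
  "assoc_inv A D H G F = canon A D (comp1 A H (comp1 A G F))
     (mk_functor (fst H \<times>\<^sub>C (fst G \<times>\<^sub>C fst F))
        (\<lambda>(z, (y, x)). ((z, y), x)) (\<lambda>(z, (y, x)). ((z, y), x)))"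

text \<open>
  The triangle identities are
  \<open>F \<Rightarrow> F \<circ> 1 \<Rightarrow> F \<circ> (G \<circ> F) \<Rightarrow> (F \<circ> G) \<circ> F \<Rightarrow> 1 \<circ> F \<Rightarrow> F\<close> and
  \<open>G \<Rightarrow> 1 \<circ> G \<Rightarrow> (G \<circ> F) \<circ> G \<Rightarrow> G \<circ> (F \<circ> G) \<Rightarrow> G \<circ> 1 \<Rightarrow> G\<close>.
\<close>

definition coKl_adjunction :: "('ao, 'am) cat \<Rightarrow> ('bo, 'bm) cat
    \<Rightarrow> ('xo, 'xm, 'ao, 'am, 'bo, 'bm) one_cell \<Rightarrow> ('yo, 'ym, 'bo, 'bm, 'ao, 'am) one_cell
    \<Rightarrow> (unit, unit, 'yo \<times> 'xo, 'ym \<times> 'xm, 'ao, 'am) two_cell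
    \<Rightarrow> ('xo \<times> 'yo, 'xm \<times> 'ym, unit, unit, 'bo, 'bm) two_cell \<Rightarrow> bool" where
  "coKl_adjunction A B F G \<eta> \<epsilon> \<longleftrightarrow>
     is_one_cell A B F \<and> is_one_cell B A G \<and>
     is_two_cell A A (id1 A) (comp1 A G F) \<eta> \<and>
     is_two_cell B B (comp1 B F G) (id1 B) \<epsilon> \<and>
     vcomp A B F (lunit A B F)
       (vcomp A B F (hcomp A B (comp1 B F G) (id1 B) F \<epsilon> (id2 A B F))
         (vcomp A B F (assoc_inv A B F G F)
           (vcomp A B F (hcomp A B F F (id1 A) (id2 A B F) \<eta>)
             (runit_inv A B F)))) = id2 A B F \<and>
     vcomp B A G (runit B A G)
       (vcomp B A G (hcomp B A G G (comp1 B F G) (id2 B A G) \<epsilon>)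
         (vcomp B A G (assoc B A A G F G)
           (vcomp B A G (hcomp B A (id1 A) (comp1 A G F) G \<eta> (id2 B A G))
             (lunit_inv B A G)))) = id2 B A G"

text \<open>The functor \<open>f(x, -)\<close>.\<close>

definition slice :: "('xo, 'xm) cat \<Rightarrow> ('ao, 'am) cat
    \<Rightarrow> ('xo \<times> 'ao, 'xm \<times> 'am, 'bo, 'bm) functr \<Rightarrow> 'xo \<Rightarrow> ('ao, 'am, 'bo, 'bm) functr" where
  "slice X A f x = mk_functor A (\<lambda>a. fobj f (x, a)) (\<lambda>m. farr f (Idn X x, m))"

definition unit_at :: "('ao, 'am) cat \<Rightarrow> (unit, unit, 'vo, 'vm, 'ao, 'am) two_cell
    \<Rightarrow> 'ao \<Rightarrow> 'am" where
  "unit_at A \<eta> = restrict (\<lambda>a. snd \<eta> ((), a)) (Obj A)"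

definition counit_at :: "('bo, 'bm) cat \<Rightarrow> ('xo \<times> 'yo, 'um, unit, unit, 'bo, 'bm) two_cell
    \<Rightarrow> 'xo \<Rightarrow> 'yo \<Rightarrow> 'bo \<Rightarrow> 'bm" where
  "counit_at B \<epsilon> x y = restrict (\<lambda>b. snd \<epsilon> ((x, y), b)) (Obj B)"

end

theory Submission
  imports Defs
begin

text \<open>
  Write \<open>(y\<^sub>0, x\<^sub>0)\<close> for the value at the only object of the functor component \<open>\<I> \<rightarrow> \<Y> \<times> \<X>\<close> of
  the unit. The counit has functor component \<open>\<X> \<times> \<Y> \<rightarrow> \<I>\<close>, so the functor component of the first
  triangle composite is \<open>\<X> \<rightarrow> \<X>, x \<mapsto> x\<^sub>0\<close>, and that of the second is constant at \<open>y\<^sub>0\<close>. The triangle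
  identities force these constant functors to be identities, i.e. \<open>\<X>\<close> and \<open>\<Y>\<close> to be terminal. Once
  they are, the functor components carry no information and the transformation components of the
  two triangle composites are the usual ones for the functors \<open>f(x\<^sub>0, -)\<close> and \<open>g(y\<^sub>0, -)\<close>.
\<close>

section \<open>Computation in product categories and with extensional functors\<close>

lemma prod_cat_simps [simp]:
  "Obj (C \<times>\<^sub>C D) = Obj C \<times> Obj D"
  "Arr (C \<times>\<^sub>C D) = Arr C \<times> Arr D"
  "Dom (C \<times>\<^sub>C D) (m, n) = (Dom C m, Dom D n)"
  "Cod (C \<times>\<^sub>C D) (m, n) = (Cod C m, Cod D n)"
  "Idn (C \<times>\<^sub>C D) (x, y) = (Idn C x, Idn D y)"
  "Comp (C \<times>\<^sub>C D) (m', n') (m, n) = (Comp C m' m, Comp D n' n)"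
  by (simp_all add: prod_cat_def)

lemma one_cat_simps [simp]: "Obj one_cat = {()}" "Arr one_cat = {()}"
  by (simp_all add: one_cat_def)

lemma mk_functor_simps [simp]:
  "fobj (mk_functor C u v) = restrict u (Obj C)"
  "farr (mk_functor C u v) = restrict v (Arr C)"
  by (simp_all add: mk_functor_def)

lemma mk_functor_eqI:
  assumes "\<And>x. x \<in> Obj C \<Longrightarrow> u x = u' x" "\<And>m. m \<in> Arr C \<Longrightarrow> v m = v' m"
  shows "mk_functor C u v = mk_functor C u' v'"
  unfolding mk_functor_def using assms by (auto cong: restrict_cong)

lemma mk_functor_eq_iff:
  "mk_functor C u v = mk_functor C u' v' \<longleftrightarrow>
     (\<forall>x\<in>Obj C. u x = u' x) \<and> (\<forall>m\<in>Arr C. v m = v' m)"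
  by (auto simp: mk_functor_def restrict_def fun_eq_iff)

text \<open>By extensionality, restriction to the carriers changes nothing. An arbitrary functor
  thus takes the form to which \<open>mk_functor_eq_iff\<close> applies.\<close>

lemma is_functor_eq_mk_functor:
  "is_functor C D F \<Longrightarrow> F = mk_functor C (fobj F) (farr F)"
  by (cases F) (simp add: is_functor_def mk_functor_def PiE_iff extensional_restrict)

lemma is_functorD:
  assumes "is_functor C D F"
  shows "x \<in> Obj C \<Longrightarrow> fobj F x \<in> Obj D"
    and "m \<in> Arr C \<Longrightarrow> farr F m \<in> Arr D"
    and "m \<in> Arr C \<Longrightarrow> Dom D (farr F m) = fobj F (Dom C m)"
    and "m \<in> Arr C \<Longrightarrow> Cod D (farr F m) = fobj F (Cod C m)"
    and "x \<in> Obj C \<Longrightarrow> farr F (Idn C x) = Idn D (fobj F x)"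
    and "m \<in> Arr C \<Longrightarrow> n \<in> Arr C \<Longrightarrow> Dom C n = Cod C m
      \<Longrightarrow> farr F (Comp C n m) = Comp D (farr F n) (farr F m)"
  using assms by (auto simp: is_functor_def)

lemma restrict_eq_iff: "restrict u S = restrict v S \<longleftrightarrow> (\<forall>x\<in>S. u x = v x)"
  by (auto simp: restrict_def fun_eq_iff)

section \<open>2-cells of the types of a unit and a counit\<close>

lemma unit_two_cell_iff:
  "is_two_cell A A (id1 A) (comp1 A (Y, g) (X, f)) (K, \<theta>) \<longleftrightarrow>
     is_functor one_cat (Y \<times>\<^sub>C X) K \<and> \<theta> \<in> {()} \<times> Obj A \<rightarrow>\<^sub>E Arr A \<and>
     (\<forall>a\<in>Obj A. Dom A (\<theta> ((), a)) = a \<and>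
        Cod A (\<theta> ((), a)) = fobj g (fst (fobj K ()), fobj f (snd (fobj K ()), a))) \<and>
     (\<forall>m\<in>Arr A. Comp A (\<theta> ((), Cod A m)) m =
        Comp A (farr g (fst (farr K ()), farr f (snd (farr K ()), m))) (\<theta> ((), Dom A m)))"
  if "category A"
proof -
  interpret A: category A by fact
  show ?thesis
  \<comment> \<open>The restricted maps in \<open>comp1\<close> unfold only at points of the
    carriers, so the values of \<open>K\<close> must be known to lie there. If \<open>K\<close> is
    not a functor, both sides are false.\<close>
  proof (cases "is_functor one_cat (Y \<times>\<^sub>C X) K")
    case True
    from is_functorD(1)[OF True, of "()"] is_functorD(2)[OF True, of "()"]
    obtain y x n m where "fobj K () = (y, x)" "farr K () = (n, m)"
      and "y \<in> Obj Y" "x \<in> Obj X" "n \<in> Arr Y" "m \<in> Arr X"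
      by auto
    then show ?thesis using True
      by (auto simp: id1_def is_nat_trans_def comp_functor_def prod_functor_def id_functor_def
          A.Dom_in A.Cod_in)
  next
    case False
    then show ?thesis by (simp add: id1_def)
  qed
qed

text \<open>The target \<open>id1 B\<close> projects its grading away, so \<open>L\<close> drops out
  of the naturality square and enters only through being a functor.\<close>

lemma counit_two_cell_iff:
  "is_two_cell B B (comp1 B (X, f) (Y, g)) (id1 B) (L, \<phi>) \<longleftrightarrow>
     is_functor (X \<times>\<^sub>C Y) one_cat L \<and> \<phi> \<in> (Obj X \<times> Obj Y) \<times> Obj B \<rightarrow>\<^sub>E Arr B \<and>
     (\<forall>x\<in>Obj X. \<forall>y\<in>Obj Y. \<forall>b\<in>Obj B. Dom B (\<phi> ((x, y), b)) = fobj f (x, fobj g (y, b)) \<and>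
        Cod B (\<phi> ((x, y), b)) = b) \<and>
     (\<forall>m\<in>Arr X. \<forall>n\<in>Arr Y. \<forall>k\<in>Arr B.
        Comp B (\<phi> ((Cod X m, Cod Y n), Cod B k)) (farr f (m, farr g (n, k))) =
        Comp B k (\<phi> ((Dom X m, Dom Y n), Dom B k)))"
  if "category B" "category X" "category Y"
proof -
  interpret B: category B by fact
  interpret X: category X by fact
  interpret Y: category Y by fact
  show ?thesis
    by (auto simp: id1_def is_nat_trans_def comp_functor_def prod_functor_def id_functor_def
        B.Dom_in B.Cod_in X.Dom_in X.Cod_in Y.Dom_in Y.Cod_in Ball_def)
qed

section \<open>Triangle composites for a pair of graded 1-cells\<close>

locale coKl_data =
  A: category A + B: category B + X: category X + Y: category Y
  for A :: "('ao, 'am) cat" and B :: "('bo, 'bm) cat"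
    and X :: "('xo, 'xm) cat" and Y :: "('yo, 'ym) cat" +
  fixes f :: "('xo \<times> 'ao, 'xm \<times> 'am, 'bo, 'bm) functr"
    and g :: "('yo \<times> 'bo, 'ym \<times> 'bm, 'ao, 'am) functr"
  assumes f: "is_functor (X \<times>\<^sub>C A) B f" and g: "is_functor (Y \<times>\<^sub>C B) A g"
begin

lemma fobj_f [simp]: "x \<in> Obj X \<Longrightarrow> a \<in> Obj A \<Longrightarrow> fobj f (x, a) \<in> Obj B"
  and farr_f [simp]: "m \<in> Arr X \<Longrightarrow> k \<in> Arr A \<Longrightarrow> farr f (m, k) \<in> Arr B"
  and Dom_f [simp]: "m \<in> Arr X \<Longrightarrow> k \<in> Arr A \<Longrightarrow> Dom B (farr f (m, k)) = fobj f (Dom X m, Dom A k)"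
  and Cod_f [simp]: "m \<in> Arr X \<Longrightarrow> k \<in> Arr A \<Longrightarrow> Cod B (farr f (m, k)) = fobj f (Cod X m, Cod A k)"
  and Idn_f [simp]: "x \<in> Obj X \<Longrightarrow> a \<in> Obj A \<Longrightarrow> farr f (Idn X x, Idn A a) = Idn B (fobj f (x, a))"
  using is_functorD(1)[OF f, of "(x, a)"] is_functorD(2-4)[OF f, of "(m, k)"]
    is_functorD(5)[OF f, of "(x, a)"] by auto

lemma fobj_g [simp]: "y \<in> Obj Y \<Longrightarrow> b \<in> Obj B \<Longrightarrow> fobj g (y, b) \<in> Obj A"
  and farr_g [simp]: "n \<in> Arr Y \<Longrightarrow> k \<in> Arr B \<Longrightarrow> farr g (n, k) \<in> Arr A"
  and Dom_g [simp]: "n \<in> Arr Y \<Longrightarrow> k \<in> Arr B \<Longrightarrow> Dom A (farr g (n, k)) = fobj g (Dom Y n, Dom B k)"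
  and Cod_g [simp]: "n \<in> Arr Y \<Longrightarrow> k \<in> Arr B \<Longrightarrow> Cod A (farr g (n, k)) = fobj g (Cod Y n, Cod B k)"
  and Idn_g [simp]: "y \<in> Obj Y \<Longrightarrow> b \<in> Obj B \<Longrightarrow> farr g (Idn Y y, Idn B b) = Idn A (fobj g (y, b))"
  using is_functorD(1)[OF g, of "(y, b)"] is_functorD(2-4)[OF g, of "(n, k)"]
    is_functorD(5)[OF g, of "(y, b)"] by auto

lemmas category_simps [simp] =
  A.Dom_in A.Cod_in A.Idn_in A.Dom_Idn A.Cod_Idn A.Comp_in A.Dom_Comp A.Cod_Comp
  B.Dom_in B.Cod_in B.Idn_in B.Dom_Idn B.Cod_Idn B.Comp_in B.Dom_Comp B.Cod_Comp
  X.Dom_in X.Cod_in X.Idn_in X.Dom_Idn X.Cod_Idn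
  Y.Dom_in Y.Cod_in Y.Idn_in Y.Dom_Idn Y.Cod_Idn

text \<open>The object is a separate variable, so that the rewrite rule also fires when the identity
  is not literally at \<open>Dom A m\<close>.\<close>

lemma A_Idn_right [simp]: "m \<in> Arr A \<Longrightarrow> Dom A m = a \<Longrightarrow> Comp A m (Idn A a) = m"
  using A.Comp_Idn_right by blast
lemma A_Idn_left [simp]: "m \<in> Arr A \<Longrightarrow> Cod A m = a \<Longrightarrow> Comp A (Idn A a) m = m"
  using A.Comp_Idn_left by blast
lemma B_Idn_right [simp]: "m \<in> Arr B \<Longrightarrow> Dom B m = b \<Longrightarrow> Comp B m (Idn B b) = m"
  using B.Comp_Idn_right by blast
lemma B_Idn_left [simp]: "m \<in> Arr B \<Longrightarrow> Cod B m = b \<Longrightarrow> Comp B (Idn B b) m = m"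
  using B.Comp_Idn_left by blast

context
  fixes K \<theta> L \<phi> x\<^sub>0 y\<^sub>0
  assumes unit: "is_two_cell A A (id1 A) (comp1 A (Y, g) (X, f)) (K, \<theta>)"
    and counit: "is_two_cell B B (comp1 B (X, f) (Y, g)) (id1 B) (L, \<phi>)"
    and K: "fobj K () = (y\<^sub>0, x\<^sub>0)"
begin

text \<open>The only arrow of \<open>one_cat\<close> is the identity of its only object, so a
  functor out of it picks an object and the identity there.\<close>

lemma base_in [simp]: "x\<^sub>0 \<in> Obj X" "y\<^sub>0 \<in> Obj Y"
  and K_arr [simp]: "farr K () = (Idn Y y\<^sub>0, Idn X x\<^sub>0)"
proof -
  have "is_functor one_cat (Y \<times>\<^sub>C X) K"
    using unit unit_two_cell_iff[OF A.category_axioms] by blast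
  from is_functorD(1,5)[OF this, of "()"] show "x\<^sub>0 \<in> Obj X" "y\<^sub>0 \<in> Obj Y"
    "farr K () = (Idn Y y\<^sub>0, Idn X x\<^sub>0)"
    by (simp_all add: K)
qed

lemma unit_simps [simp]:
  assumes "a \<in> Obj A"
  shows "\<theta> ((), a) \<in> Arr A" "Dom A (\<theta> ((), a)) = a"
    "Cod A (\<theta> ((), a)) = fobj g (y\<^sub>0, fobj f (x\<^sub>0, a))"
  using unit assms unfolding unit_two_cell_iff[OF A.category_axioms] by (auto simp: K)

lemma counit_simps [simp]:
  assumes "x \<in> Obj X" "y \<in> Obj Y" "b \<in> Obj B"
  shows "\<phi> ((x, y), b) \<in> Arr B" "Dom B (\<phi> ((x, y), b)) = fobj f (x, fobj g (y, b))"
    "Cod B (\<phi> ((x, y), b)) = b"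
  using counit assms
  unfolding counit_two_cell_iff[OF B.category_axioms X.category_axioms Y.category_axioms]
  by auto

text \<open>The grade travels as \<open>x\<close>, \<open>(x, ())\<close>,
  \<open>(x, (y\<^sub>0, x\<^sub>0))\<close>, \<open>((x, y\<^sub>0), x\<^sub>0)\<close>,
  \<open>((), x\<^sub>0)\<close>, \<open>x\<^sub>0\<close>: the counit consumes the original
  \<open>x\<close> and the copy created by the unit survives. The coherence cells contribute only
  identity components.\<close>

lemma triangle_F:
  "vcomp A B (X, f) (lunit A B (X, f))
     (vcomp A B (X, f)
        (hcomp A B (comp1 B (X, f) (Y, g)) (id1 B) (X, f) (L, \<phi>) (id2 A B (X, f)))
       (vcomp A B (X, f) (assoc_inv A B (X, f) (Y, g) (X, f))
         (vcomp A B (X, f) (hcomp A B (X, f) (X, f) (id1 A) (id2 A B (X, f)) (K, \<theta>))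
           (runit_inv A B (X, f))))) =
   (mk_functor X (\<lambda>_. x\<^sub>0) (\<lambda>_. Idn X x\<^sub>0),
    restrict (\<lambda>(x, a). Comp B (\<phi> ((x, y\<^sub>0), fobj f (x\<^sub>0, a))) (farr f (Idn X x, \<theta> ((), a))))
      (Obj X \<times> Obj A))"
  by (auto simp: runit_inv_def lunit_def id1_def id2_def assoc_inv_def comp_functor_def
      prod_functor_def id_functor_def K restrict_eq_iff intro!: mk_functor_eqI)

text \<open>Here the grade travels as \<open>y\<close>, \<open>((), y)\<close>,
  \<open>((y\<^sub>0, x\<^sub>0), y)\<close>, \<open>(y\<^sub>0, (x\<^sub>0, y))\<close>,
  \<open>(y\<^sub>0, ())\<close>, \<open>y\<^sub>0\<close>.\<close>

lemma triangle_G: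
  "vcomp B A (Y, g) (runit B A (Y, g))
     (vcomp B A (Y, g)
        (hcomp B A (Y, g) (Y, g) (comp1 B (X, f) (Y, g)) (id2 B A (Y, g)) (L, \<phi>))
       (vcomp B A (Y, g) (assoc B A A (Y, g) (X, f) (Y, g))
         (vcomp B A (Y, g)
            (hcomp B A (id1 A) (comp1 A (Y, g) (X, f)) (Y, g) (K, \<theta>) (id2 B A (Y, g)))
           (lunit_inv B A (Y, g))))) =
   (mk_functor Y (\<lambda>_. y\<^sub>0) (\<lambda>_. Idn Y y\<^sub>0),
    restrict (\<lambda>(y, b). Comp A (farr g (Idn Y y\<^sub>0, \<phi> ((x\<^sub>0, y), b))) (\<theta> ((), fobj g (y, b))))
      (Obj Y \<times> Obj B))"
  by (auto simp: lunit_inv_def runit_def id1_def id2_def assoc_def comp_functor_def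
      prod_functor_def id_functor_def K restrict_eq_iff intro!: mk_functor_eqI)

text \<open>The typing of all cells is given, so only the two triangle identities remain. Comparing
  their functor components with identity functors yields the first four conditions; comparing
  transformations yields the last two.\<close>

lemma coKl_adjunction_iff:
  "coKl_adjunction A B (X, f) (Y, g) (K, \<theta>) (L, \<phi>) \<longleftrightarrow>
     (\<forall>x\<in>Obj X. x = x\<^sub>0) \<and> (\<forall>m\<in>Arr X. m = Idn X x\<^sub>0) \<and>
     (\<forall>y\<in>Obj Y. y = y\<^sub>0) \<and> (\<forall>n\<in>Arr Y. n = Idn Y y\<^sub>0) \<and>
     (\<forall>x\<in>Obj X. \<forall>a\<in>Obj A.
        Comp B (\<phi> ((x, y\<^sub>0), fobj f (x\<^sub>0, a))) (farr f (Idn X x, \<theta> ((), a))) = Idn B (fobj f (x, a))) \<and>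
     (\<forall>y\<in>Obj Y. \<forall>b\<in>Obj B.
        Comp A (farr g (Idn Y y\<^sub>0, \<phi> ((x\<^sub>0, y), b))) (\<theta> ((), fobj g (y, b))) = Idn A (fobj g (y, b)))"
  using X.category_axioms Y.category_axioms f g unit counit
  unfolding coKl_adjunction_def triangle_F triangle_G
  by (auto simp: id2_def id_functor_def mk_functor_eq_iff restrict_eq_iff)

end
end

section \<open>Terminal categories\<close>

lemma iso_one_cat_iff:
  assumes "category C"
  shows "C \<cong>\<^sub>C one_cat \<longleftrightarrow> (\<exists>x. Obj C = {x} \<and> Arr C = {Idn C x})"
proof
  assume "C \<cong>\<^sub>C one_cat"
  then obtain F G where F: "is_functor C one_cat F" and G: "is_functor one_cat C G"
    and GF: "comp_functor C G F = id_functor C"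
    unfolding iso_cat_def by blast
  \<comment> \<open>The round trip through \<open>one_cat\<close> is the identity, so every object
    and arrow of \<open>C\<close> is the value of \<open>G\<close> at \<open>()\<close>.\<close>
  define x where "x = fobj G ()"
  have x: "x \<in> Obj C" and G_arr: "farr G () = Idn C x"
    using is_functorD(1,5)[OF G, of "()"] by (simp_all add: x_def one_cat_def)
  have "y = x" if "y \<in> Obj C" for y
    using GF that unfolding comp_functor_def id_functor_def mk_functor_eq_iff by (simp add: x_def)
  moreover have "m = Idn C x" if "m \<in> Arr C" for m
    using GF that G_arr unfolding comp_functor_def id_functor_def mk_functor_eq_iff by simp
  ultimately show "\<exists>x. Obj C = {x} \<and> Arr C = {Idn C x}"
    using x category.Idn_in[OF assms x] by blast
next
  interpret category C by fact
  assume "\<exists>x. Obj C = {x} \<and> Arr C = {Idn C x}"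
  then obtain x where x: "Obj C = {x}" "Arr C = {Idn C x}"
    by blast
  \<comment> \<open>Closure under composition forces the composite to be the only arrow; the
    constant functor into \<open>C\<close> needs this to preserve composition.\<close>
  then have "Comp C (Idn C x) (Idn C x) = Idn C x" "Dom C (Idn C x) = x" "Cod C (Idn C x) = x"
    using Comp_in[of "Idn C x" "Idn C x"] Dom_Idn[of x] Cod_Idn[of x] by auto
  then have "is_functor one_cat C (mk_functor one_cat (\<lambda>_. x) (\<lambda>_. Idn C x))"
    and "is_functor C one_cat (mk_functor C (\<lambda>_. ()) (\<lambda>_. ()))"
    using x by (simp_all add: is_functor_def)
  moreover have
    "comp_functor C (mk_functor one_cat (\<lambda>_. x) (\<lambda>_. Idn C x)) (mk_functor C (\<lambda>_. ()) (\<lambda>_. ()))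
       = id_functor C"
    "comp_functor one_cat (mk_functor C (\<lambda>_. ()) (\<lambda>_. ())) (mk_functor one_cat (\<lambda>_. x) (\<lambda>_. Idn C x))
       = id_functor one_cat"
    using x by (simp_all add: comp_functor_def id_functor_def mk_functor_eq_iff)
  ultimately show "C \<cong>\<^sub>C one_cat"
    unfolding iso_cat_def by blast
qed

context coKl_data
begin

lemma terminal_if_coKl_adjunction:
  assumes "coKl_adjunction A B (X, f) (Y, g) \<eta> \<epsilon>"
  obtains x y where "Obj X = {x}" "Arr X = {Idn X x}" "Obj Y = {y}" "Arr Y = {Idn Y y}"
proof -
  obtain K \<theta> L \<phi> where eq: "\<eta> = (K, \<theta>)" "\<epsilon> = (L, \<phi>)"
    by fastforce
  obtain x y where K: "fobj K () = (y, x)"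
    by fastforce
  have cells: "is_two_cell A A (id1 A) (comp1 A (Y, g) (X, f)) (K, \<theta>)"
    "is_two_cell B B (comp1 B (X, f) (Y, g)) (id1 B) (L, \<phi>)"
    using assms unfolding eq coKl_adjunction_def by blast+
  \<comment> \<open>\<open>coKl_adjunction_iff\<close> bounds the carriers only from above; these
    memberships rule out the empty category.\<close>
  have "x \<in> Obj X" "y \<in> Obj Y"
    using base_in[OF cells K] by blast+
  moreover from this have "Idn X x \<in> Arr X" "Idn Y y \<in> Arr Y"
    by simp_all
  ultimately show ?thesis
    using assms that unfolding eq coKl_adjunction_iff[OF cells K] by blast
qed

end

section \<open>Adjunctions with terminal gradings\<close>

locale coKl_terminal_data = coKl_data +
  fixes x y
  assumes Obj_X: "Obj X = {x}" and Arr_X: "Arr X = {Idn X x}"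
    and Obj_Y: "Obj Y = {y}" and Arr_Y: "Arr Y = {Idn Y y}"
begin

lemma in_carriers [simp]: "x \<in> Obj X" "y \<in> Obj Y"
  by (simp_all add: Obj_X Obj_Y)

lemma Comp_X [simp]: "Comp X (Idn X x) (Idn X x) = Idn X x"
  and Comp_Y [simp]: "Comp Y (Idn Y y) (Idn Y y) = Idn Y y"
  using X.Comp_Idn_right[of "Idn X x"] Y.Comp_Idn_right[of "Idn Y y"] by simp_all

lemma slice_functors: "is_functor A B (slice X A f x)" "is_functor B A (slice Y B g y)"
proof -
  have "farr f (Idn X x, Comp A n m) = Comp B (farr f (Idn X x, n)) (farr f (Idn X x, m))"
    if "m \<in> Arr A" "n \<in> Arr A" "Dom A n = Cod A m" for m n
    using is_functorD(6)[OF f, of "(Idn X x, m)" "(Idn X x, n)"] that by simp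
  then show "is_functor A B (slice X A f x)"
    by (simp add: is_functor_def slice_def)
  have "farr g (Idn Y y, Comp B n m) = Comp A (farr g (Idn Y y, n)) (farr g (Idn Y y, m))"
    if "m \<in> Arr B" "n \<in> Arr B" "Dom B n = Cod B m" for m n
    using is_functorD(6)[OF g, of "(Idn Y y, m)" "(Idn Y y, n)"] that by simp
  then show "is_functor B A (slice Y B g y)"
    by (simp add: is_functor_def slice_def)
qed

text \<open>Together with \<open>counit_grading\<close>, this names the functor component that
  terminality forces on the unit and the counit, so that it can be restored from an ordinary
  adjunction.\<close>

definition unit_grading where
  "unit_grading = mk_functor one_cat (\<lambda>_. (y, x)) (\<lambda>_. (Idn Y y, Idn X x))"

definition counit_grading where
  "counit_grading = mk_functor (X \<times>\<^sub>C Y) (\<lambda>_. ()) (\<lambda>_. ())"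

lemma functor_from_one_cat_iff: "is_functor one_cat (Y \<times>\<^sub>C X) K \<longleftrightarrow> K = unit_grading"
proof
  assume K: "is_functor one_cat (Y \<times>\<^sub>C X) K"
  have "fobj K () = (y, x)" "farr K () = (Idn Y y, Idn X x)"
    using is_functorD(1,2)[OF K, of "()"] by (auto simp: Obj_X Obj_Y Arr_X Arr_Y)
  then show "K = unit_grading"
    unfolding unit_grading_def by (subst is_functor_eq_mk_functor[OF K]) (simp add: mk_functor_eq_iff)
next
  show "K = unit_grading \<Longrightarrow> is_functor one_cat (Y \<times>\<^sub>C X) K"
    by (simp add: is_functor_def unit_grading_def)
qed

lemma functor_to_one_cat_iff: "is_functor (X \<times>\<^sub>C Y) one_cat L \<longleftrightarrow> L = counit_grading"
proof
  show "L = counit_grading" if "is_functor (X \<times>\<^sub>C Y) one_cat L"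
    unfolding counit_grading_def by (subst is_functor_eq_mk_functor[OF that]) (simp add: mk_functor_eq_iff)
  show "L = counit_grading \<Longrightarrow> is_functor (X \<times>\<^sub>C Y) one_cat L"
    by (simp add: is_functor_def counit_grading_def Obj_X Obj_Y Arr_X Arr_Y)
qed

text \<open>\<open>unit_at\<close> and \<open>counit_at\<close> forget the grading functors and the
  values off the carriers. The extra conditions on the right pin down exactly this forgotten
  data.\<close>

lemma coKl_adjunction_iff_cat_adjunction:
  "coKl_adjunction A B (X, f) (Y, g) (K, \<theta>) (L, \<phi>) \<longleftrightarrow>
     K = unit_grading \<and> \<theta> \<in> extensional ({()} \<times> Obj A) \<and>
     L = counit_grading \<and> \<phi> \<in> extensional (({x} \<times> {y}) \<times> Obj B) \<and>
     cat_adjunction A B (slice X A f x) (slice Y B g y)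
       (unit_at A (K, \<theta>)) (counit_at B (L, \<phi>) x y)"
    (is "?L \<longleftrightarrow> ?R")
proof -
  \<comment> \<open>Both sides are reduced to \<open>U\<close>, \<open>V\<close> and
    \<open>T\<close>: typing of the unit, typing of the counit, and the triangle equations.\<close>
  define U where "U \<longleftrightarrow> is_two_cell A A (id1 A) (comp1 A (Y, g) (X, f)) (K, \<theta>)"
  define V where "V \<longleftrightarrow> is_two_cell B B (comp1 B (X, f) (Y, g)) (id1 B) (L, \<phi>)"
  define T where "T \<longleftrightarrow>
    (\<forall>a\<in>Obj A. Comp B (\<phi> ((x, y), fobj f (x, a))) (farr f (Idn X x, \<theta> ((), a))) = Idn B (fobj f (x, a))) \<and>
    (\<forall>b\<in>Obj B. Comp A (farr g (Idn Y y, \<phi> ((x, y), b))) (\<theta> ((), fobj g (y, b))) = Idn A (fobj g (y, b)))"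
  have U: "U \<longleftrightarrow> K = unit_grading \<and> \<theta> \<in> extensional ({()} \<times> Obj A) \<and>
      is_nat_trans A A (id_functor A) (comp_functor A (slice Y B g y) (slice X A f x))
        (unit_at A (K, \<theta>))"
    unfolding U_def unit_two_cell_iff[OF A.category_axioms] functor_from_one_cat_iff
    by (auto simp: unit_grading_def is_nat_trans_def comp_functor_def id_functor_def slice_def
        unit_at_def PiE_iff)
  \<comment> \<open>The arrows of \<open>X\<close> and \<open>Y\<close> are now only identities, so
    joint naturality becomes naturality in \<open>B\<close> between slices.\<close>
  have V: "V \<longleftrightarrow> L = counit_grading \<and> \<phi> \<in> extensional (({x} \<times> {y}) \<times> Obj B) \<and>
      is_nat_trans B B (comp_functor B (slice X A f x) (slice Y B g y)) (id_functor B)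
        (counit_at B (L, \<phi>) x y)"
    unfolding V_def functor_to_one_cat_iff
      counit_two_cell_iff[OF B.category_axioms X.category_axioms Y.category_axioms]
    by (auto simp: is_nat_trans_def comp_functor_def id_functor_def slice_def
        counit_at_def PiE_iff Obj_X Obj_Y Arr_X Arr_Y)
  have "?L \<longleftrightarrow> U \<and> V \<and> T"
  \<comment> \<open>\<open>coKl_adjunction_iff\<close> presupposes well-typed 2-cells; without them
    there is no adjunction by definition.\<close>
  proof (cases "U \<and> V")
    case True
    then have "fobj K () = (y, x)"
      using U by (simp add: unit_grading_def)
    from coKl_adjunction_iff[OF _ _ this] True show ?thesis
      by (simp add: U_def V_def T_def Obj_X Obj_Y Arr_X Arr_Y)
  next
    case False
    then show ?thesis
      unfolding coKl_adjunction_def U_def V_def by blast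
  qed
  moreover have "?R \<longleftrightarrow> U \<and> V \<and> T"
  proof -
    \<comment> \<open>Slices are restricted to the arrow carriers, so they evaluate at unit and
      counit components only once these are known to be arrows.\<close>
    have "(\<forall>a\<in>Obj A. Comp B (counit_at B (L, \<phi>) x y (fobj (slice X A f x) a))
            (farr (slice X A f x) (unit_at A (K, \<theta>) a)) = Idn B (fobj (slice X A f x) a)) \<and>
        (\<forall>b\<in>Obj B. Comp A (farr (slice Y B g y) (counit_at B (L, \<phi>) x y b))
            (unit_at A (K, \<theta>) (fobj (slice Y B g y) b)) = Idn A (fobj (slice Y B g y) b)) \<longleftrightarrow> T"
      if "\<And>a. a \<in> Obj A \<Longrightarrow> \<theta> ((), a) \<in> Arr A" "\<And>b. b \<in> Obj B \<Longrightarrow> \<phi> ((x, y), b) \<in> Arr B"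
      using that by (simp add: T_def unit_at_def counit_at_def slice_def)
    moreover have "\<theta> ((), a) \<in> Arr A" if "a \<in> Obj A"
        "is_nat_trans A A F G (unit_at A (K, \<theta>))" for a F G
      using that by (auto simp: is_nat_trans_def unit_at_def PiE_iff)
    moreover have "\<phi> ((x, y), b) \<in> Arr B" if "b \<in> Obj B"
        "is_nat_trans B B F G (counit_at B (L, \<phi>) x y)" for b F G
      using that by (auto simp: is_nat_trans_def counit_at_def PiE_iff)
    ultimately show ?thesis
      unfolding cat_adjunction_def U V using slice_functors by blast
  qed
  ultimately show ?thesis by blast
qed

text \<open>Injectivity rests on the forced grading functors and on extensionality; surjectivity on
  restoring both.\<close>

lemma bij_betw_adjunctions:
  "bij_betw (\<lambda>(\<eta>, \<epsilon>). (unit_at A \<eta>, counit_at B \<epsilon> x y))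
     {(\<eta>, \<epsilon>). coKl_adjunction A B (X, f) (Y, g) \<eta> \<epsilon>}
     {(\<eta>, \<epsilon>). cat_adjunction A B (slice X A f x) (slice Y B g y) \<eta> \<epsilon>}"
    (is "bij_betw ?h ?S ?T")
proof (rule bij_betw_byWitness)
  \<comment> \<open>The inverse reinstates the forced gradings and reindexes the transformations
    over the single grade.\<close>
  let ?k = "\<lambda>(\<eta>, \<epsilon>). ((unit_grading, restrict (\<lambda>(_, a). \<eta> a) ({()} \<times> Obj A)),
    (counit_grading, restrict (\<lambda>(_, b). \<epsilon> b) (({x} \<times> {y}) \<times> Obj B)))"
  have hk: "?h (?k p) = p" if "p \<in> ?T" for p
  proof -
    obtain \<eta> \<epsilon> where p: "p = (\<eta>, \<epsilon>)" by fastforce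
    then have "\<eta> \<in> extensional (Obj A)" "\<epsilon> \<in> extensional (Obj B)"
      using that by (auto simp: cat_adjunction_def is_nat_trans_def PiE_iff)
    then show ?thesis
      by (auto simp: p unit_at_def counit_at_def fun_eq_iff restrict_def extensional_def)
  qed
  then show "\<forall>p\<in>?T. ?h (?k p) = p" by blast
  show "\<forall>p\<in>?S. ?k (?h p) = p"
    by (auto simp: coKl_adjunction_iff_cat_adjunction unit_at_def counit_at_def fun_eq_iff
        restrict_def extensional_def)
  show "?h ` ?S \<subseteq> ?T"
    by (auto simp: coKl_adjunction_iff_cat_adjunction)
  show "?k ` ?T \<subseteq> ?S"
  proof
    fix q assume "q \<in> ?k ` ?T"
    then obtain p where p: "p \<in> ?T" "q = ?k p" by blast
    \<comment> \<open>The conditions on gradings and extensionality hold for \<open>q\<close> by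
      construction, so the ordinary adjunction \<open>?h q\<close> suffices.\<close>
    then have "?h q \<in> ?T" using hk by simp
    then show "q \<in> ?S"
      unfolding p(2) by (auto simp: coKl_adjunction_iff_cat_adjunction split: prod.splits)
  qed
qed

end

text \<open>"Amounts to" is expressed as a bijection of unit-counit pairs. The second half assumes
  terminal gradings rather than an adjunction, so it also lifts every ordinary adjunction between
  the slices.\<close>

theorem lemma3p14:
  fixes A :: "('ao, 'am) cat" and B :: "('bo, 'bm) cat"
    and X :: "('xo, 'xm) cat" and Y :: "('yo, 'ym) cat"
    and f :: "('xo \<times> 'ao, 'xm \<times> 'am, 'bo, 'bm) functr"
    and g :: "('yo \<times> 'bo, 'ym \<times> 'bm, 'ao, 'am) functr"
  assumes "category A" and "category B"
    and "is_one_cell A B (X, f)" and "is_one_cell B A (Y, g)"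
  shows "(\<forall>\<eta> \<epsilon>. coKl_adjunction A B (X, f) (Y, g) \<eta> \<epsilon> \<longrightarrow>
            X \<cong>\<^sub>C one_cat \<and> Y \<cong>\<^sub>C one_cat \<and>
            (\<exists>x y. Obj X = {x} \<and> Obj Y = {y} \<and>
               cat_adjunction A B (slice X A f x) (slice Y B g y)
                 (unit_at A \<eta>) (counit_at B \<epsilon> x y))) \<and>
         (\<forall>x y. X \<cong>\<^sub>C one_cat \<and> Y \<cong>\<^sub>C one_cat \<and> Obj X = {x} \<and> Obj Y = {y} \<longrightarrow>
            bij_betw (\<lambda>(\<eta>, \<epsilon>). (unit_at A \<eta>, counit_at B \<epsilon> x y))
              {(\<eta>, \<epsilon>). coKl_adjunction A B (X, f) (Y, g) \<eta> \<epsilon>}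
              {(\<eta>, \<epsilon>). cat_adjunction A B (slice X A f x) (slice Y B g y) \<eta> \<epsilon>})"
proof -
  interpret coKl_data A B X Y f g
    using assms by (simp add: coKl_data_def coKl_data_axioms_def)
  have terminal: "coKl_terminal_data A B X Y f g x y"
    if "Obj X = {x}" "Arr X = {Idn X x}" "Obj Y = {y}" "Arr Y = {Idn Y y}" for x y
    using that by unfold_locales
  show ?thesis
  proof (intro conjI allI impI)
    fix \<eta> \<epsilon>
    assume adj: "coKl_adjunction A B (X, f) (Y, g) \<eta> \<epsilon>"
    from terminal_if_coKl_adjunction[OF adj] obtain x y
      where xy: "Obj X = {x}" "Arr X = {Idn X x}" "Obj Y = {y}" "Arr Y = {Idn Y y}" .
    then show "X \<cong>\<^sub>C one_cat" "Y \<cong>\<^sub>C one_cat"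
      by (auto simp: iso_one_cat_iff X.category_axioms Y.category_axioms)
    interpret coKl_terminal_data A B X Y f g x y
      using terminal xy by blast
    have "cat_adjunction A B (slice X A f x) (slice Y B g y) (unit_at A \<eta>) (counit_at B \<epsilon> x y)"
      using adj coKl_adjunction_iff_cat_adjunction by (cases \<eta>; cases \<epsilon>) blast
    then show "\<exists>x y. Obj X = {x} \<and> Obj Y = {y} \<and>
        cat_adjunction A B (slice X A f x) (slice Y B g y) (unit_at A \<eta>) (counit_at B \<epsilon> x y)"
      using xy by blast
  next
    fix x y
    assume "X \<cong>\<^sub>C one_cat \<and> Y \<cong>\<^sub>C one_cat \<and> Obj X = {x} \<and> Obj Y = {y}"
    \<comment> \<open>The isomorphisms with \<open>one_cat\<close> supply the arrow carriers; their
      points are \<open>x\<close> and \<open>y\<close> because the object carriers are these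
      singletons.\<close>
    then interpret coKl_terminal_data A B X Y f g x y
      by (intro terminal) (auto simp: iso_one_cat_iff X.category_axioms Y.category_axioms)
    show "bij_betw (\<lambda>(\<eta>, \<epsilon>). (unit_at A \<eta>, counit_at B \<epsilon> x y))
        {(\<eta>, \<epsilon>). coKl_adjunction A B (X, f) (Y, g) \<eta> \<epsilon>}
        {(\<eta>, \<epsilon>). cat_adjunction A B (slice X A f x) (slice Y B g y) \<eta> \<epsilon>}"
      by (rule bij_betw_adjunctions)
  qed
qed

end
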